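(* Let $f(x)=x^x$ for $x>0$ and let $f^{(n)}$ denote its $n$-th derivative (with $f^{(0)}=f$). Then for every integer $n\ge 1$ and every $x>0$, $$f^{(n)}(x)=f^{(n-1)}(x)\ln(x)+\sum_{i=0}^{n-1}\Omega(n,i)\,\frac{f^{(n-1-i)}(x)}{x^i}.$$
   Context: The integers $\Omega(a,b)$, for $a\in\mathbb{Z}_{>0}$ and $b\in\mathbb{Z}_{\ge 0}$, are defined recursively by: $\Omega(a,0)=1$; $\Omega(a,b)=0$ if $b\ge a$ and $b\ge 1$; $\Omega(a,1)=\Omega(a-1,1)+1$ for $a\ge 2$; and $\Omega(a,b)=\Omega(a-1,b)-(b-1)\,\Omega(a-1,b-1)$ for $2\le b\le a-1$. *)

theory Defs
  imports "HOL-Analysis.Analysis"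
begin

text \<open>Only \<open>a > 0\<close> is meaningful; the recursion never leaves that range.\<close>

fun Omega :: "nat \<Rightarrow> nat \<Rightarrow> int" where
  "Omega a b =
    (if b = 0 then 1
     else if b \<ge> a then 0
     else if b = 1 then Omega (a - 1) 1 + 1
     else Omega (a - 1) b - (int b - 1) * Omega (a - 1) (b - 1))"

declare Omega.simps [simp del]

lemma Omega_0: "a > 0 \<Longrightarrow> Omega a 0 = 1"
  by (simp add: Omega.simps)

lemma Omega_ge: "a > 0 \<Longrightarrow> b \<ge> a \<Longrightarrow> b \<ge> 1 \<Longrightarrow> Omega a b = 0"
  by (simp add: Omega.simps)

lemma Omega_1: "a \<ge> 2 \<Longrightarrow> Omega a 1 = Omega (a - 1) 1 + 1"
  by (subst Omega.simps) simp

lemma Omega_rec: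
  "2 \<le> b \<Longrightarrow> b \<le> a - 1 \<Longrightarrow>
    Omega a b = Omega (a - 1) b - (int b - 1) * Omega (a - 1) (b - 1)"
  by (subst Omega.simps) auto

text \<open>
  Total on the reals, but only its values for \<open>x > 0\<close> matter: the derivatives
  of every order at a positive point depend only on these.
\<close>

definition self_power :: "real \<Rightarrow> real" where
  "self_power x = x powr x"

end

theory Submission imports Defs begin

text \<open>
  Since \<open>f = self_power\<close> satisfies \<open>f' = f ln + f\<close> on the positive reals, the identity for
  \<open>n = 1\<close> is immediate, and each further identity is the derivative of the preceding one.
  The product rule on \<open>f^(n-1) ln\<close> gives \<open>f^(n) ln\<close> and the stray term \<open>f^(n-1) / x\<close>; on the
  summand with index \<open>i\<close> it gives a term with index \<open>i\<close> and one with index \<open>i + 1\<close> and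
  factor \<open>- i\<close>.  Collecting terms, the new coefficients satisfy exactly the recursion of
  \<open>Omega\<close> (see \<open>Omega_expansion_Suc\<close>), the stray term being the
  extra \<open>1\<close> in the rule for \<open>Omega a 1\<close>.

  Differentiability is part of the induction: the identity for \<open>n\<close> expresses
  \<open>f^(n)\<close> on an open set through \<open>ln\<close>, powers of \<open>x\<close> and derivatives of lower order, so
  it makes \<open>f^(n)\<close> differentiable.  The induction is therefore over all lower orders at once.
\<close>

text \<open>
  Merging the cases of the recursion lets a single rewrite treat all terms of a sum
  with positive index.
\<close>

lemma Omega_Suc_Suc:
  assumes "i \<le> m"
  shows "Omega (Suc (Suc m)) (Suc i) =
    Omega (Suc m) (Suc i) + (if i = 0 then 1 else 0) - int i * Omega (Suc m) i"
proof (cases "i = 0")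
  case True
  then show ?thesis using Omega_1[of "Suc (Suc m)"] by simp
next
  case False
  then show ?thesis using assms Omega_rec[of "Suc i" "Suc (Suc m)"] by simp
qed

text \<open>
  With \<open>D k\<close> in the role of the \<open>k\<close>-th derivative, this is the expression claimed for
  derivative number \<open>m + 1\<close>.  The family \<open>D\<close> is arbitrary because passing from one
  expression to the next uses only \<open>(D k)' = D (k + 1)\<close>, not the function behind it.
\<close>

definition Omega_expansion :: "(nat \<Rightarrow> real \<Rightarrow> real) \<Rightarrow> nat \<Rightarrow> real \<Rightarrow> real" where
  "Omega_expansion D m x =
    D m x * ln x + (\<Sum>i\<le>m. of_int (Omega (Suc m) i) * (D (m - i) x / x ^ i))"

text \<open>
  The left-hand side is what the product rule yields for the derivative of
  \<open>Omega_expansion D m\<close>.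
\<close>

lemma Omega_expansion_Suc:
  fixes D :: "nat \<Rightarrow> real \<Rightarrow> real"
  shows "D (Suc m) x * ln x + D m x / x +
      (\<Sum>i\<le>m. of_int (Omega (Suc m) i) *
        (D (Suc m - i) x / x ^ i - real i * D (m - i) x / x ^ Suc i)) =
    Omega_expansion D (Suc m) x"
proof -
  let ?t = "\<lambda>i. D (m - i) x / x ^ Suc i"
  let ?c = "\<lambda>i. real_of_int (Omega (Suc m) i)"
  have "(\<Sum>i\<le>Suc m. of_int (Omega (Suc (Suc m)) i) * (D (Suc m - i) x / x ^ i)) =
      D (Suc m) x + (\<Sum>i\<le>m. of_int (Omega (Suc (Suc m)) (Suc i)) * ?t i)"
    by (subst sum.atMost_Suc_shift) (simp add: Omega_0)
  also have "(\<Sum>i\<le>m. of_int (Omega (Suc (Suc m)) (Suc i)) * ?t i) =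
      (\<Sum>i\<le>m. ?c (Suc i) * ?t i + (if i = 0 then ?t i else 0) - real i * ?c i * ?t i)"
    by (intro sum.cong refl) (auto simp: Omega_Suc_Suc algebra_simps)
  also have "\<dots> = (\<Sum>i\<le>m. ?c (Suc i) * ?t i) + D m x / x - (\<Sum>i\<le>m. real i * ?c i * ?t i)"
    by (simp add: sum.distrib sum_subtractf)
  finally have new: "(\<Sum>i\<le>Suc m. of_int (Omega (Suc (Suc m)) i) * (D (Suc m - i) x / x ^ i)) =
      D (Suc m) x + ((\<Sum>i\<le>m. ?c (Suc i) * ?t i) + D m x / x - (\<Sum>i\<le>m. real i * ?c i * ?t i))" .
  \<comment> \<open>A vanishing term with index \<open>Suc m\<close> makes the sum range match that of the new sum.\<close>
  have "(\<Sum>i\<le>m. ?c i * (D (Suc m - i) x / x ^ i)) =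
      (\<Sum>i\<le>Suc m. ?c i * (D (Suc m - i) x / x ^ i))"
    by (simp add: Omega_ge)
  also have "\<dots> = D (Suc m) x + (\<Sum>i\<le>m. ?c (Suc i) * ?t i)"
    by (subst sum.atMost_Suc_shift) (simp add: Omega_0)
  finally have old: "(\<Sum>i\<le>m. ?c i * (D (Suc m - i) x / x ^ i)) =
      D (Suc m) x + (\<Sum>i\<le>m. ?c (Suc i) * ?t i)" .
  have "(\<Sum>i\<le>m. ?c i * (D (Suc m - i) x / x ^ i - real i * D (m - i) x / x ^ Suc i)) =
      (\<Sum>i\<le>m. ?c i * (D (Suc m - i) x / x ^ i)) - (\<Sum>i\<le>m. real i * ?c i * ?t i)"
    unfolding sum_subtractf[symmetric] by (intro sum.cong refl) (simp add: algebra_simps)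
  then show ?thesis
    unfolding Omega_expansion_def new old by simp
qed

lemma has_real_derivative_Omega_expansion:
  fixes D :: "nat \<Rightarrow> real \<Rightarrow> real"
  assumes D: "\<And>k. k \<le> m \<Longrightarrow> (D k has_real_derivative D (Suc k) x) (at x)"
    and "x > 0"
  shows "(Omega_expansion D m has_real_derivative Omega_expansion D (Suc m) x) (at x)"
proof -
  have quotient: "((\<lambda>x. D (m - i) x / x ^ i) has_real_derivative
      D (Suc m - i) x / x ^ i - real i * D (m - i) x / x ^ Suc i) (at x)" if "i \<le> m" for i
  proof -
    have "(D (m - i) has_real_derivative D (Suc m - i) x) (at x)"
      using D[of "m - i"] that by (simp add: Suc_diff_le)
    then have "((\<lambda>x. D (m - i) x / x ^ i) has_real_derivative
        (D (Suc m - i) x * x ^ i - D (m - i) x * (real i * x ^ (i - 1))) / (x ^ i * x ^ i)) (at x)"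
      using \<open>x > 0\<close> by (auto intro!: derivative_eq_intros)
    also have "(D (Suc m - i) x * x ^ i - D (m - i) x * (real i * x ^ (i - 1))) / (x ^ i * x ^ i) =
        D (Suc m - i) x / x ^ i - real i * D (m - i) x / x ^ Suc i"
      using \<open>x > 0\<close> that by (cases i) (simp_all add: field_simps)
    finally show ?thesis .
  qed
  have "((\<lambda>x. D m x * ln x + (\<Sum>i\<le>m. of_int (Omega (Suc m) i) * (D (m - i) x / x ^ i)))
      has_real_derivative D (Suc m) x * ln x + D m x / x +
      (\<Sum>i\<le>m. of_int (Omega (Suc m) i) *
        (D (Suc m - i) x / x ^ i - real i * D (m - i) x / x ^ Suc i))) (at x)"
    using \<open>x > 0\<close> D[of m]
    by (intro DERIV_add DERIV_sum DERIV_cmult quotient)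
      (auto intro!: derivative_eq_intros simp: divide_inverse)
  moreover have "Omega_expansion D m =
      (\<lambda>x. D m x * ln x + (\<Sum>i\<le>m. of_int (Omega (Suc m) i) * (D (m - i) x / x ^ i)))"
    by (simp add: fun_eq_iff Omega_expansion_def)
  ultimately show ?thesis
    by (simp only: Omega_expansion_Suc)
qed

lemma has_real_derivative_self_power:
  assumes "x > 0"
  shows "(self_power has_real_derivative self_power x * ln x + self_power x) (at x)"
proof -
  have "((\<lambda>x. x powr x) has_real_derivative x powr x * ln x + x powr x) (at x)"
    using DERIV_powr[OF DERIV_ident assms DERIV_ident] assms by (simp add: algebra_simps)
  then show ?thesis by (simp add: self_power_def[abs_def])
qed

text \<open>
  A single derivative statement carries both differentiability and the value of the next
  derivative through the induction.
\<close>

lemma has_real_derivative_iterated_deriv_self_power: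
  assumes "x > 0"
  shows "((deriv ^^ m) self_power has_real_derivative
    Omega_expansion (\<lambda>k. (deriv ^^ k) self_power) m x) (at x)"
  using assms
proof (induction m arbitrary: x rule: less_induct)
  case (less m)
  let ?D = "\<lambda>k. (deriv ^^ k) self_power"
  show ?case
  proof (cases m)
    case 0
    then show ?thesis
      using has_real_derivative_self_power[OF less.prems]
      by (simp add: Omega_expansion_def Omega_0)
  next
    case (Suc p)
    have D: "?D (Suc k) y = Omega_expansion ?D k y" if "k \<le> p" "y > 0" for k y
      using less.IH[of k y] that Suc by (simp add: DERIV_imp_deriv)
    have "(Omega_expansion ?D p has_real_derivative Omega_expansion ?D m x) (at x)"
      unfolding Suc
    proof (rule has_real_derivative_Omega_expansion)
      show "(?D k has_real_derivative ?D (Suc k) x) (at x)" if "k \<le> p" for k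
        unfolding D[OF that less.prems] using less.IH[of k x] less.prems that Suc by simp
    qed (rule less.prems)
    \<comment> \<open>The identity holds near \<open>x\<close>, so the derivative carries over to the iterated one.\<close>
    then show ?thesis
      by (rule has_field_derivative_transform_within_open[where S = "{0<..}"])
        (use less.prems D Suc in auto)
  qed
qed

theorem proposition1p2:
  fixes n :: nat and x :: real
  assumes "n \<ge> 1" and "x > 0"
  shows "(deriv ^^ (n - 1)) self_power differentiable (at x) \<and>
    (deriv ^^ n) self_power x =
      (deriv ^^ (n - 1)) self_power x * ln x +
      (\<Sum>i = 0..n - 1. of_int (Omega n i) * ((deriv ^^ (n - 1 - i)) self_power x / x ^ i))"
proof -
  obtain m where n: "n = Suc m" using assms(1) by (cases n) auto
  note D = has_real_derivative_iterated_deriv_self_power[OF assms(2), of m]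
  have "(deriv ^^ m) self_power differentiable (at x)"
    using D by (auto simp: real_differentiable_def)
  moreover have "(deriv ^^ n) self_power x =
      Omega_expansion (\<lambda>k. (deriv ^^ k) self_power) m x"
    using D by (simp add: n DERIV_imp_deriv)
  ultimately show ?thesis
    by (simp add: n Omega_expansion_def atMost_atLeast0)
qed

end
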